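(* Let $F$ be a finite forest of arborescences and let $D$ be a finite directed graph with directed path-width at least $|V(F)|-1$. Then $D$ has a butterfly minor isomorphic to $F$.
   Context: An arborescence is a directed graph obtained from a tree with a distinguished vertex $u$ (the root) by orienting all edges away from $u$; thus for every other vertex $v$ there is exactly one directed path from $u$ to $v$. A forest of arborescences is a directed graph each of whose (weakly connected) components is an arborescence. A directed path-decomposition of a directed graph $D=(V,E)$ is a pair $(P,\mathcal V)$ consisting of a path $P$ with vertices $t_1,\dots,t_n$ in this order ($n\ge 1$) and a family $\mathcal V=(V_i)_{1\le i\le n}$ of subsets of $V$ such that: (i) $V=\bigcup_{i} V_i$; (ii) if $i<j<l$ then $V_i\cap V_l\subseteq V_j$; (iii) for every edge $(x,y)\in E$ there exist $i\le j$ with $x\in V_i$ and $y\in V_j$. Its width is $\max_i |V_i|-1$. The directed path-width of $D$ is the smallest width of a directed path-decomposition of $D$. An edge $e=(u,v)$ of a directed graph is contractible if $d^-(v)=1$ or $d^+(u)=1$, where $d^-$ and $d^+$ denote in-degree and out-degree. A directed graph $D'$ is a butterfly minor of $D$ if $D'$ can be obtained from $D$ by a sequence of vertex deletions, edge deletions and contractions of contractible edges (each edge being contractible in the directed graph at the moment it is contracted). *)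

theory Defs
  imports "Graph_Theory.Graph_Theory"
begin

text \<open>
  Directed graphs are the \<open>pre_digraph\<close>s of \<^theory>\<open>Graph_Theory.Digraph\<close>, so loops and parallel
  arcs are allowed unless excluded. Undirected graphs are symmetric loop-free digraphs, whose arcs
  are pairs of vertices. Recall that \<^const>\<open>connected\<close> means weakly connected (and nonempty).
\<close>

text \<open>
  The library's \<^const>\<open>tree\<close> only forbids directed cycles, so it is not the undirected notion
  needed here: in a symmetric digraph every edge gives a directed cycle of length two, which must
  not be counted as a cycle of the undirected graph.
\<close>

definition undirected_tree :: "'a pair_pre_digraph \<Rightarrow> bool" where
  "undirected_tree T \<longleftrightarrow>
     sym_digraph (with_proj T) \<and> loopfree_digraph (with_proj T) \<and> connected (with_proj T) \<and>
     \<not> (\<exists>p. pre_digraph.cycle (with_proj T) p \<and> length p \<ge> 3)"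

text \<open>
  The edge \<open>xy\<close> of the tree \<open>T\<close> is oriented from \<open>x\<close> to \<open>y\<close>, away from the root \<open>u\<close>, iff the
  path of \<open>T\<close> from \<open>u\<close> to \<open>y\<close> ends with this edge.
\<close>

definition arborescence :: "('a, 'b) pre_digraph \<Rightarrow> bool" where
  "arborescence G \<longleftrightarrow> nomulti_digraph G \<and>
     (\<exists>T u. undirected_tree T \<and> u \<in> pverts T \<and> verts G = pverts T \<and>
        arcs_ends G = {(x, y). \<exists>p. pre_digraph.apath (with_proj T) u (p @ [(x, y)]) y})"

definition forest_of_arborescences :: "('a, 'b) pre_digraph \<Rightarrow> bool" where
  "forest_of_arborescences G \<longleftrightarrow> wf_digraph G \<and>
     (\<forall>H. pre_digraph.max_subgraph G connected H \<longrightarrow> arborescence H)"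

text \<open>The path \<open>t\<^sub>1, \<dots>, t\<^sub>n\<close> together with its bags is the nonempty list of the bags.\<close>

definition directed_path_decomposition :: "('a, 'b) pre_digraph \<Rightarrow> 'a set list \<Rightarrow> bool" where
  "directed_path_decomposition D Vs \<longleftrightarrow>
     Vs \<noteq> [] \<and>
     verts D = \<Union> (set Vs) \<and>
     (\<forall>i j l. i < j \<and> j < l \<and> l < length Vs \<longrightarrow> Vs ! i \<inter> Vs ! l \<subseteq> Vs ! j) \<and>
     (\<forall>(x, y) \<in> arcs_ends D. \<exists>i j. i \<le> j \<and> j < length Vs \<and> x \<in> Vs ! i \<and> y \<in> Vs ! j)"

text \<open>Integer-valued, since the width for the digraph without vertices is \<open>-1\<close>.\<close>

definition decomposition_width :: "'a set list \<Rightarrow> int" where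
  "decomposition_width Vs = int (Max (card ` set Vs)) - 1"

text \<open>
  Meaningful for digraphs with finitely many vertices: then all bags are finite, there is a
  decomposition (with a single bag), and widths are bounded below by \<open>-1\<close>.
\<close>

definition directed_path_width :: "('a, 'b) pre_digraph \<Rightarrow> int" where
  "directed_path_width D =
     (LEAST w. \<exists>Vs. directed_path_decomposition D Vs \<and> w = decomposition_width Vs)"

definition contractible_arc :: "('a, 'b) pre_digraph \<Rightarrow> 'b \<Rightarrow> bool" where
  "contractible_arc D e \<longleftrightarrow>
     e \<in> arcs D \<and> (in_degree D (head D e) = 1 \<or> out_degree D (tail D e) = 1)"

text \<open>
  Contraction of \<open>e = (u, v)\<close> names the merged vertex \<open>u\<close>. Loops and parallel arcs that arise are
  kept; they can be removed by arc deletions, so keeping them does not affect which simple digraphs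
  are butterfly minors.
\<close>

definition contract_arc :: "('a, 'b) pre_digraph \<Rightarrow> 'b \<Rightarrow> ('a, 'b) pre_digraph" where
  "contract_arc D e =
     (let f = (\<lambda>x. if x = head D e then tail D e else x) in
      \<lparr> verts = f ` verts D, arcs = arcs D - {e}, tail = f \<circ> tail D, head = f \<circ> head D \<rparr>)"

inductive has_butterfly_minor :: "('a, 'b) pre_digraph \<Rightarrow> ('a, 'b) pre_digraph \<Rightarrow> bool"
  for D where
  refl: "has_butterfly_minor D D"
| del_vert: "has_butterfly_minor D H \<Longrightarrow> v \<in> verts H \<Longrightarrow>
    has_butterfly_minor D (pre_digraph.del_vert H v)"
| del_arc: "has_butterfly_minor D H \<Longrightarrow> e \<in> arcs H \<Longrightarrow>
    has_butterfly_minor D (pre_digraph.del_arc H e)"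
| contract: "has_butterfly_minor D H \<Longrightarrow> contractible_arc H e \<Longrightarrow>
    has_butterfly_minor D (contract_arc H e)"

end

theory Submission
  imports Defs
begin

text \<open>
  The proof follows Diestel's short proof of the theorem of Bienstock, Robertson, Seymour and Thomas
  that large path-width forces every forest as a minor, with directed boundaries in place of
  undirected ones. Let \<open>k\<close> be one less than the number of vertices of \<open>F\<close>. A set \<open>X\<close> of vertices
  of \<open>D\<close> is swept if it can be built up from the empty set vertex by vertex such that, before each
  step, fewer than \<open>k\<close> vertices of the current set have an out-neighbour outside it. If all of \<open>D\<close>
  were swept, the boundaries would form a directed path-decomposition of width less than \<open>k\<close>
  (\<open>directed_path_width_less_if_swept\<close>). So the assumption on \<open>D\<close> says that no swept set is
  everything.

  The forest \<open>F\<close> is grown inside swept sets, parents before children. At each stage a part \<open>U\<close> of \<open>F\<close>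
  has been embedded into a swept set \<open>X\<close>, with pairwise disjoint directed paths of \<open>D\<close> as branch sets
  whose last vertices, the tips, form exactly the out-boundary of \<open>X\<close>; and \<open>X\<close> is maximal, in the
  sense that no larger swept set has a boundary of at most \<open>card U\<close> vertices. The next vertex of \<open>F\<close>
  has its parent in \<open>U\<close> or is a root. Since the tip of the parent has an out-neighbour \<open>v\<close> outside \<open>X\<close>,
  the vertex \<open>v\<close> can start the new branch set (\<open>new_branch_vertex\<close>). To restore the
  invariant, \<open>insert v X\<close> is enlarged to a maximal swept set \<open>Z\<close> whose boundary is still of size at
  most \<open>card U + 1\<close>, and the tips are pushed to the boundary of \<open>Z\<close> along disjoint paths
  (\<open>maximal_swept_expansion_insert\<close>). Such paths exist by Menger's theorem unless some set in
  between has at most \<open>card U\<close> boundary vertices. A set of this kind with least boundary would be swept,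
  by submodularity (\<open>swept_if_card_out_boundary_minimal\<close>), which contradicts the maximality
  of \<open>X\<close>. The needed form of Menger's theorem, \<open>tipped_expansion_linkage\<close>, has a short proof in
  terms of boundaries.

  The result is a subgraph of \<open>D\<close> with all in-degrees at most one. Hence all its arcs are contractible,
  and contracting those inside the branch sets yields \<open>F\<close>
  (\<open>butterfly_minor_if_expansion\<close>). Of \<open>F\<close> only two facts enter: every vertex has at most one
  incoming arc, and there is a rank function that increases along arcs
  (\<open>forest_of_arborescences_parent_unique_and_ranked\<close>).
\<close>

section \<open>Out-boundaries and sweeps\<close>

text \<open>
  The digraph is swept from its last bag to its first. If \<open>X\<close> is the union of the bags from some
  position onwards, then the arcs that enter \<open>X\<close> go from an earlier to a later bag and cost nothing,
  whereas the tail of an arc that leaves \<open>X\<close> has to be carried along to a bag further to the front.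
  This is why only the arcs leaving \<open>X\<close> count.
\<close>

definition out_boundary :: "('v \<times> 'v) set \<Rightarrow> 'v set \<Rightarrow> 'v set" where
  "out_boundary E X = {x \<in> X. \<exists>y. (x, y) \<in> E \<and> y \<notin> X}"

lemma out_boundary_subset: "out_boundary E X \<subseteq> X"
  by (auto simp: out_boundary_def)

lemma finite_out_boundary: "finite X \<Longrightarrow> finite (out_boundary E X)"
  using finite_subset[OF out_boundary_subset] .

lemma out_boundary_insert: "out_boundary E (insert v X) \<subseteq> insert v (out_boundary E X)"
  by (auto simp: out_boundary_def)

text \<open>
  Both \<open>out_boundary E (X \<inter> Y)\<close> and \<open>out_boundary E (X \<union> Y)\<close> lie in the union of the boundaries
  of \<open>X\<close> and \<open>Y\<close>. A vertex of both of them lies in \<open>X \<inter> Y\<close> and has an out-neighbour outside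
  \<open>X \<union> Y\<close>, so it is also in both boundaries on the right.
\<close>

lemma card_out_boundary_submodular:
  assumes "finite X" "finite Y"
  shows "card (out_boundary E (X \<inter> Y)) + card (out_boundary E (X \<union> Y))
    \<le> card (out_boundary E X) + card (out_boundary E Y)"
proof -
  let ?b = "out_boundary E"
  have fin: "finite (?b (X \<inter> Y))" "finite (?b (X \<union> Y))" "finite (?b X)" "finite (?b Y)"
    using assms by (auto intro: finite_out_boundary)
  have "card (?b (X \<inter> Y)) + card (?b (X \<union> Y))
      = card (?b (X \<inter> Y) \<union> ?b (X \<union> Y)) + card (?b (X \<inter> Y) \<inter> ?b (X \<union> Y))"
    using fin(1,2) by (rule card_Un_Int)
  also have "\<dots> \<le> card (?b X \<union> ?b Y) + card (?b X \<inter> ?b Y)"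
    using fin by (intro add_mono card_mono) (auto simp: out_boundary_def)
  also have "\<dots> = card (?b X) + card (?b Y)"
    using card_Un_Int[OF fin(3,4)] by simp
  finally show ?thesis .
qed

text \<open>
  Each step adds one vertex \<open>v\<close> and stands for the new first bag \<open>insert v (out_boundary E X)\<close>,
  which has at most \<open>k\<close> elements by the bound on the boundary. So the sweeps of the whole vertex
  set by this rule are directed path-decompositions of width less than \<open>k\<close> in which the bags are
  as small as the order of the vertices permits.
\<close>

inductive swept :: "('v \<times> 'v) set \<Rightarrow> nat \<Rightarrow> 'v set \<Rightarrow> bool" for E k where
  empty: "swept E k {}"
| insert: "swept E k X \<Longrightarrow> v \<notin> X \<Longrightarrow> card (out_boundary E X) < k \<Longrightarrow> swept E k (insert v X)"

text \<open>
  Intersecting every stage \<open>W\<close> of a sweep with \<open>Y\<close> gives a sweep of \<open>W \<inter> Y\<close>: the minimality of \<open>Y\<close>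
  yields \<open>card (out_boundary E Y) \<le> card (out_boundary E (W \<union> Y))\<close>, and then submodularity says
  that the boundary of \<open>W \<inter> Y\<close> is at most as large as that of \<open>W\<close>.
\<close>

lemma swept_Int_if_card_out_boundary_minimal:
  assumes "swept E k W" "W \<subseteq> Z" "finite Z" "Y \<subseteq> Z"
    and min: "\<And>Y'. Y \<subseteq> Y' \<Longrightarrow> Y' \<subseteq> Z \<Longrightarrow> card (out_boundary E Y) \<le> card (out_boundary E Y')"
  shows "swept E k (W \<inter> Y)"
  using assms(1,2)
proof induction
  case empty
  show ?case by (simp add: swept.empty)
next
  case (insert W v)
  then have IH: "swept E k (W \<inter> Y)" by simp
  show ?case
  proof (cases "v \<in> Y")
    case True
    have fin: "finite W" "finite Y"
      using insert.prems finite_subset[OF _ \<open>finite Z\<close>] \<open>Y \<subseteq> Z\<close> by simp_all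
    have "card (out_boundary E Y) \<le> card (out_boundary E (W \<union> Y))"
      using insert.prems \<open>Y \<subseteq> Z\<close> by (intro min) auto
    with card_out_boundary_submodular[OF fin, of E]
    have "card (out_boundary E (W \<inter> Y)) < k"
      using insert.hyps(3) by linarith
    with IH insert.hyps(2) have "swept E k (insert v (W \<inter> Y))"
      by (intro swept.insert) auto
    with True show ?thesis by simp
  next
    case False
    with IH show ?thesis by simp
  qed
qed

lemma swept_if_card_out_boundary_minimal:
  assumes "swept E k Z" "finite Z" "Y \<subseteq> Z"
    and "\<And>Y'. Y \<subseteq> Y' \<Longrightarrow> Y' \<subseteq> Z \<Longrightarrow> card (out_boundary E Y) \<le> card (out_boundary E Y')"
  shows "swept E k Y"
proof -
  have "swept E k (Z \<inter> Y)"
    by (rule swept_Int_if_card_out_boundary_minimal[of E k Z Z Y]) (use assms in blast)+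
  also have "Z \<inter> Y = Y" using assms(3) by blast
  finally show ?thesis .
qed

lemma maximal_swept_superset:
  assumes "finite V" "X \<subseteq> V" "swept E k X" "card (out_boundary E X) \<le> m"
  obtains Z where "X \<subseteq> Z" "Z \<subseteq> V" "swept E k Z" "card (out_boundary E Z) \<le> m"
    "\<And>Y. Z \<subset> Y \<Longrightarrow> Y \<subseteq> V \<Longrightarrow> swept E k Y \<Longrightarrow> m < card (out_boundary E Y)"
proof -
  define \<Z> where "\<Z> = {Z. X \<subseteq> Z \<and> Z \<subseteq> V \<and> swept E k Z \<and> card (out_boundary E Z) \<le> m}"
  have "finite \<Z>"
    by (rule finite_subset[of _ "Pow V"]) (use \<open>finite V\<close> in \<open>auto simp: \<Z>_def\<close>)
  moreover have "X \<in> \<Z>" using assms by (simp add: \<Z>_def)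
  ultimately have "\<exists>Z \<in> \<Z>. \<forall>Y \<in> \<Z>. Z \<subseteq> Y \<longrightarrow> Z = Y"
    by (intro finite_has_maximal) auto
  then obtain Z where Z: "Z \<in> \<Z>" and max: "\<And>Y. Y \<in> \<Z> \<Longrightarrow> Z \<subseteq> Y \<Longrightarrow> Z = Y"
    by blast
  show thesis
  proof (rule that[of Z])
    fix Y assume Y: "Z \<subset> Y" "Y \<subseteq> V" "swept E k Y"
    then have "Y \<notin> \<Z>" using max[of Y] by blast
    with Y Z show "m < card (out_boundary E Y)" by (simp add: \<Z>_def subset_trans[of X Z Y] not_le)
  qed (use Z in \<open>simp_all add: \<Z>_def\<close>)
qed

section \<open>Path-decompositions from sweeps\<close>

text \<open>
  Every step of the sweep is prepended as the bag \<open>insert v (out_boundary E X)\<close>. The induction has to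
  carry along that the first bag contains the boundary. This gives the interval property, since a
  vertex of the new bag that occurs again later is a boundary vertex of \<open>X\<close> and hence lies in the
  old first bag. It also gives the arc condition: an arc from \<open>X\<close> to \<open>v\<close> starts in the boundary,
  hence within the new bag, and an arc from \<open>v\<close> to \<open>X\<close> leads to a later bag.
\<close>

lemma decomposition_if_swept:
  assumes "swept E k X" "finite X"
  shows "\<exists>Vs. Vs \<noteq> [] \<and> \<Union> (set Vs) = X \<and> out_boundary E X \<subseteq> hd Vs \<and>
    (\<forall>B \<in> set Vs. card B \<le> k) \<and>
    (\<forall>i j l. i < j \<and> j < l \<and> l < length Vs \<longrightarrow> Vs ! i \<inter> Vs ! l \<subseteq> Vs ! j) \<and>
    (\<forall>x \<in> X. \<forall>y \<in> X. (x, y) \<in> E \<longrightarrow>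
      (\<exists>i j. i \<le> j \<and> j < length Vs \<and> x \<in> Vs ! i \<and> y \<in> Vs ! j))"
  using assms
proof induction
  case empty
  show ?case by (intro exI[of _ "[{}]"]) (auto simp: out_boundary_def)
next
  case (insert X v)
  then obtain Vs where Vs: "Vs \<noteq> []" "\<Union> (set Vs) = X" "out_boundary E X \<subseteq> hd Vs"
      "\<forall>B \<in> set Vs. card B \<le> k"
      "\<And>i j l. i < j \<Longrightarrow> j < l \<Longrightarrow> l < length Vs \<Longrightarrow> Vs ! i \<inter> Vs ! l \<subseteq> Vs ! j"
      "\<And>x y. x \<in> X \<Longrightarrow> y \<in> X \<Longrightarrow> (x, y) \<in> E \<Longrightarrow>
        \<exists>i j. i \<le> j \<and> j < length Vs \<and> x \<in> Vs ! i \<and> y \<in> Vs ! j"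
    by (auto simp: Ball_def)
  let ?B = "insert v (out_boundary E X)"
  have bag: "card ?B \<le> k"
    using insert.hyps insert.prems out_boundary_subset[of E X]
    by (subst card_insert_disjoint) (auto intro: finite_out_boundary)
  have hd0: "hd Vs = Vs ! 0" using Vs(1) by (simp add: hd_conv_nth)
  have interval: "(?B # Vs) ! i \<inter> (?B # Vs) ! l \<subseteq> (?B # Vs) ! j"
    if ijl: "i < j" "j < l" "l < length (?B # Vs)" for i j l
  proof (cases i)
    case (Suc i')
    with ijl Vs(5)[of i' "j - 1" "l - 1"] show ?thesis by (auto simp: nth_Cons')
  next
    case 0
    have l: "Vs ! (l - 1) \<subseteq> X" using Vs(2) ijl nth_mem[of "l - 1" Vs] by fastforce
    show ?thesis
    proof
      fix x assume "x \<in> (?B # Vs) ! i \<inter> (?B # Vs) ! l"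
      with 0 ijl have x: "x \<in> ?B" "x \<in> Vs ! (l - 1)" by (auto simp: nth_Cons')
      with l insert.hyps(2) have "x \<in> Vs ! 0" using Vs(3) hd0 by auto
      have "x \<in> Vs ! (j - 1)"
      proof (cases "j = 1")
        case False
        with ijl have "0 < j - 1" "j - 1 < l - 1" "l - 1 < length Vs" by auto
        from Vs(5)[OF this] x \<open>x \<in> Vs ! 0\<close> show ?thesis by blast
      qed (use \<open>x \<in> Vs ! 0\<close> in simp)
      with ijl show "x \<in> (?B # Vs) ! j" by (auto simp: nth_Cons')
    qed
  qed
  have arcs: "\<exists>i j. i \<le> j \<and> j < length (?B # Vs) \<and> x \<in> (?B # Vs) ! i \<and> y \<in> (?B # Vs) ! j"
    if xy: "x \<in> insert v X" "y \<in> insert v X" "(x, y) \<in> E" for x y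
  proof -
    consider "y = v" "x \<in> ?B" | "x = v" "y \<in> X" | "x \<in> X" "y \<in> X"
      using xy insert.hyps(2) by (auto simp: out_boundary_def)
    then show ?thesis
    proof cases
      case 1
      then show ?thesis by (intro exI[of _ 0]) auto
    next
      case 2
      then obtain j where "j < length Vs" "y \<in> Vs ! j"
        using Vs(2) by (auto simp: set_conv_nth)
      with 2 show ?thesis by (intro exI[of _ 0] exI[of _ "Suc j"]) auto
    next
      case 3
      with Vs(6) xy(3) obtain i j where "i \<le> j" "j < length Vs" "x \<in> Vs ! i" "y \<in> Vs ! j"
        by blast
      then show ?thesis by (intro exI[of _ "Suc i"] exI[of _ "Suc j"]) auto
    qed
  qed
  have "\<Union> (set (?B # Vs)) = insert v X" using Vs(2) out_boundary_subset[of E X] by auto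
  then show ?case
    using bag Vs(4) interval arcs out_boundary_insert[of E v X]
    by (intro exI[of _ "?B # Vs"]) auto
qed

lemma decomposition_width_ge: "decomposition_width Vs \<ge> -1"
  by (simp add: decomposition_width_def)

text \<open>
  The integers are not well-ordered, so that the least width exists needs the lower bound \<open>-1\<close>.
\<close>

lemma directed_path_width_le:
  assumes "directed_path_decomposition D Vs"
  shows "directed_path_width D \<le> decomposition_width Vs"
proof -
  let ?W = "\<lambda>w. \<exists>Vs. directed_path_decomposition D Vs \<and> w = decomposition_width Vs"
  obtain m where m: "?W m" "\<And>w. ?W w \<Longrightarrow> nat (m + 1) \<le> nat (w + 1)"
    using ex_has_least_nat[of ?W "decomposition_width Vs" "\<lambda>w. nat (w + 1)"] assms by blast
  have le: "m \<le> w" if "?W w" for w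
    using m(2)[OF that] m(1) that decomposition_width_ge by (smt (verit) nat_le_eq_zle)
  then have "directed_path_width D = m"
    unfolding directed_path_width_def using m(1) by (intro Least_equality) auto
  with le assms show ?thesis by blast
qed

lemma directed_path_width_less_if_swept:
  assumes "fin_digraph D" "swept (arcs_ends D) k (verts D)"
  shows "directed_path_width D < int k"
proof -
  interpret fin_digraph D by fact
  from decomposition_if_swept[OF assms(2) finite_verts] obtain Vs where
    Vs: "Vs \<noteq> []" "\<Union> (set Vs) = verts D" "out_boundary (arcs_ends D) (verts D) \<subseteq> hd Vs"
      "\<forall>B \<in> set Vs. card B \<le> k"
      "\<forall>i j l. i < j \<and> j < l \<and> l < length Vs \<longrightarrow> Vs ! i \<inter> Vs ! l \<subseteq> Vs ! j"
      "\<forall>x \<in> verts D. \<forall>y \<in> verts D. (x, y) \<in> arcs_ends D \<longrightarrow>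
        (\<exists>i j. i \<le> j \<and> j < length Vs \<and> x \<in> Vs ! i \<and> y \<in> Vs ! j)"
    by (elim exE conjE) (rule that)
  have "\<forall>(x, y) \<in> arcs_ends D. \<exists>i j. i \<le> j \<and> j < length Vs \<and> x \<in> Vs ! i \<and> y \<in> Vs ! j"
  proof (rule ballI, rule case_prodI2)
    fix e x y assume "e \<in> arcs_ends D" "e = (x, y)"
    then have "(x, y) \<in> arcs_ends D" by simp
    with Vs(6) adj_in_verts[OF this]
    show "\<exists>i j. i \<le> j \<and> j < length Vs \<and> x \<in> Vs ! i \<and> y \<in> Vs ! j" by simp
  qed
  with Vs(1,2,5) have decomp: "directed_path_decomposition D Vs"
    by (simp add: directed_path_decomposition_def)
  have "Max (card ` set Vs) \<le> k" using Vs(1,4) by simp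
  then have "decomposition_width Vs < int k" by (simp add: decomposition_width_def)
  with directed_path_width_le[OF decomp] show ?thesis by simp
qed

section \<open>Expansions of a digraph\<close>

text \<open>
  \<open>H\<close> is a model of the digraph with vertex set \<open>U\<close> and arcs \<open>A \<inter> U \<times> U\<close>, where \<open>\<beta>\<close> sends every
  vertex of \<open>H\<close> to the vertex whose branch set it belongs to. All in-degrees of \<open>H\<close> are at most one,
  the rank \<open>\<rho>\<close> excludes directed cycles, and each branch set has exactly one vertex that is not
  the head of an arc inside the branch set. So the branch sets are arborescences, a fact that is
  stated by local conditions because these are easy to maintain when vertices are added or arcs are
  contracted. Since in-degrees are at most one, every arc of \<open>H\<close> is contractible.
\<close>

definition expansion ::
  "('a \<times> 'a) set \<Rightarrow> 'a set \<Rightarrow> ('c, 'd) pre_digraph \<Rightarrow> ('c \<Rightarrow> 'a) \<Rightarrow> bool" where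
  "expansion A U H \<beta> \<longleftrightarrow>
     wf_digraph H \<and> inj_on (head H) (arcs H) \<and>
     (\<exists>\<rho> :: 'c \<Rightarrow> nat. \<forall>a \<in> arcs H. \<rho> (tail H a) < \<rho> (head H a)) \<and>
     \<beta> ` verts H \<subseteq> U \<and>
     (\<forall>a \<in> arcs H. \<beta> (tail H a) = \<beta> (head H a) \<or> (\<beta> (tail H a), \<beta> (head H a)) \<in> A) \<and>
     (\<forall>f \<in> U. \<exists>!y. y \<in> verts H \<and> \<beta> y = f \<and>
        (\<forall>a \<in> arcs H. head H a = y \<longrightarrow> \<beta> (tail H a) \<noteq> f)) \<and>
     (\<forall>f \<in> U. \<forall>g \<in> U. (f, g) \<in> A \<longrightarrow>
        (\<exists>a \<in> arcs H. \<beta> (tail H a) = f \<and> \<beta> (head H a) = g))"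

lemma expansion_empty: "expansion A {} (D\<lparr>verts := {}, arcs := {}\<rparr>) \<beta>"
  by (auto simp: expansion_def wf_digraph_def)

text \<open>
  The set \<open>I\<close> has at most one element. It is empty if \<open>v\<close> starts the branch set of a root \<open>g\<close>, and
  otherwise consists of an arc to \<open>v\<close> from the branch set of \<open>g\<close> itself, which thereby grows, or
  from the branch set of the parent of \<open>g\<close>.
\<close>

lemma expansion_add_vert:
  assumes exp: "expansion A U (D\<lparr>verts := S, arcs := R\<rparr>) \<beta>"
    and v: "v \<notin> S" and I: "\<And>a. a \<in> I \<Longrightarrow> tail D a \<in> S \<and> head D a = v"
    and I1: "\<And>a b. a \<in> I \<Longrightarrow> b \<in> I \<Longrightarrow> a = b"
    and g: "g \<in> U \<and> (\<exists>a \<in> I. \<beta> (tail D a) = g) \<or>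
      g \<notin> U \<and> (\<forall>f \<in> U. (f, g) \<in> A \<longleftrightarrow> (\<exists>a \<in> I. \<beta> (tail D a) = f)) \<and>
      (\<forall>f \<in> insert g U. (g, f) \<notin> A)"
  shows "expansion A (insert g U) (D\<lparr>verts := insert v S, arcs := I \<union> R\<rparr>) (\<beta>(v := g))"
proof -
  have wf: "tail D b \<in> S" "head D b \<in> S" if "b \<in> R" for b
    using exp that by (auto simp: expansion_def wf_digraph_def)
  have ends: "tail D b \<noteq> v" "head D b \<noteq> v" if "b \<in> R" for b
    using wf[OF that] v by auto
  have new: "tail D b \<noteq> v" "head D b = v" "\<beta> (tail D b) \<in> U" if "b \<in> I" for b
    using I[OF that] v exp by (auto simp: expansion_def)
  have \<beta>U: "\<beta> x \<in> U" if "x \<in> S" for x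
    using exp that by (auto simp: expansion_def)
  obtain \<rho> :: "_ \<Rightarrow> nat" where \<rho>: "\<And>b. b \<in> R \<Longrightarrow> \<rho> (tail D b) < \<rho> (head D b)"
    using exp by (auto simp: expansion_def)
  let ?H = "D\<lparr>verts := insert v S, arcs := I \<union> R\<rparr>" and ?\<beta> = "\<beta>(v := g)"
  have 1: "wf_digraph ?H"
    using wf I by (auto simp: wf_digraph_def)
  have 2: "inj_on (head D) (I \<union> R)"
  proof (rule inj_onI)
    fix b c assume bc: "b \<in> I \<union> R" "c \<in> I \<union> R" "head D b = head D c"
    then have "b \<in> I \<and> c \<in> I \<or> b \<in> R \<and> c \<in> R" using new(2) ends(2) by (metis UnE)
    with bc(3) I1 exp show "b = c" by (auto simp: expansion_def inj_on_def)
  qed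
  have 3: "\<exists>\<rho> :: _ \<Rightarrow> nat. \<forall>b \<in> I \<union> R. \<rho> (tail D b) < \<rho> (head D b)"
  proof (intro exI ballI)
    fix b assume "b \<in> I \<union> R"
    \<comment> \<open>The sum has at most one term, so \<open>v\<close> is ranked just above the tail of its arc, if there is one.\<close>
    then show "(\<rho>(v := Suc (\<Sum>a\<in>I. \<rho> (tail D a)))) (tail D b)
        < (\<rho>(v := Suc (\<Sum>a\<in>I. \<rho> (tail D a)))) (head D b)"
    proof
      assume "b \<in> I"
      with I1 have "I = {b}" by blast
      with new show ?thesis by simp
    next
      assume "b \<in> R"
      with ends \<rho> show ?thesis by simp
    qed
  qed
  have 4: "?\<beta> ` insert v S \<subseteq> insert g U"
    using \<beta>U by auto
  have 5: "?\<beta> (tail D b) = ?\<beta> (head D b) \<or> (?\<beta> (tail D b), ?\<beta> (head D b)) \<in> A"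
    if "b \<in> I \<union> R" for b
    using that
  proof
    assume b: "b \<in> I"
    with I1 have "I = {b}" by blast
    with g new[OF b] show ?thesis by auto
  next
    assume "b \<in> R"
    with ends exp show ?thesis by (simp add: expansion_def)
  qed
  have 6: "\<exists>!y. y \<in> insert v S \<and> ?\<beta> y = f \<and>
      (\<forall>b \<in> I \<union> R. head D b = y \<longrightarrow> ?\<beta> (tail D b) \<noteq> f)" if f: "f \<in> insert g U" for f
  proof (cases "f \<in> U")
    case True
    with exp have ex1: "\<exists>!y. y \<in> S \<and> \<beta> y = f \<and> (\<forall>b \<in> R. head D b = y \<longrightarrow> \<beta> (tail D b) \<noteq> f)"
      by (simp add: expansion_def)
    have "(y \<in> insert v S \<and> ?\<beta> y = f \<and> (\<forall>b \<in> I \<union> R. head D b = y \<longrightarrow> ?\<beta> (tail D b) \<noteq> f)) \<longleftrightarrow>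
      (y \<in> S \<and> \<beta> y = f \<and> (\<forall>b \<in> R. head D b = y \<longrightarrow> \<beta> (tail D b) \<noteq> f))" for y
    proof (cases "y = v")
      case True
      with \<open>f \<in> U\<close> g v new show ?thesis by auto
    next
      case False
      with new ends show ?thesis by auto
    qed
    with ex1 show ?thesis by presburger
  next
    case False
    with f have "f = g" "g \<notin> U" by auto
    show ?thesis
    proof (rule ex1I[of _ v])
      show "v \<in> insert v S \<and> ?\<beta> v = f \<and> (\<forall>b \<in> I \<union> R. head D b = v \<longrightarrow> ?\<beta> (tail D b) \<noteq> f)"
      proof -
        have "?\<beta> (tail D b) \<noteq> g" if "b \<in> I \<union> R" for b
        proof -
          have "tail D b \<noteq> v" "\<beta> (tail D b) \<in> U" using that new ends \<beta>U[OF wf(1)] by blast+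
          with \<open>g \<notin> U\<close> show ?thesis by auto
        qed
        with \<open>f = g\<close> show ?thesis by simp
      qed
    next
      fix y assume "y \<in> insert v S \<and> ?\<beta> y = f \<and> (\<forall>b \<in> I \<union> R. head D b = y \<longrightarrow> ?\<beta> (tail D b) \<noteq> f)"
      with \<open>f = g\<close> \<open>g \<notin> U\<close> \<beta>U show "y = v" by (auto split: if_splits)
    qed
  qed
  have 7: "\<exists>b \<in> I \<union> R. ?\<beta> (tail D b) = f \<and> ?\<beta> (head D b) = h"
    if "(f, h) \<in> A" "f \<in> insert g U" "h \<in> insert g U" for f h
  proof (cases "f \<in> U \<and> h \<in> U")
    case True
    with that(1) exp have "\<exists>b \<in> R. \<beta> (tail D b) = f \<and> \<beta> (head D b) = h"
      by (auto simp: expansion_def)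
    with ends show ?thesis by (metis UnI2 fun_upd_other)
  next
    case False
    with that g have "h = g" "g \<notin> U" "f \<in> U" by auto
    with that(1) g obtain a where "a \<in> I" "\<beta> (tail D a) = f" by blast
    with new \<open>h = g\<close> show ?thesis by auto
  qed
  show ?thesis
    unfolding expansion_def using 1 2 3 4 5 6 7 by (simp del: fun_upd_apply)
qed

text \<open>
  The set \<open>T\<close> of tips contains one vertex of each branch set. These are the places at which the
  expansion is continued; the aim is always that \<open>T\<close> is the out-boundary of \<open>X\<close>, so that an arc
  leaving \<open>X\<close> is available at each tip.
\<close>

definition tipped_expansion ::
  "('c, 'd) pre_digraph \<Rightarrow> ('a \<times> 'a) set \<Rightarrow> 'a set \<Rightarrow> 'c set \<Rightarrow> 'c set \<Rightarrow> bool" where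
  "tipped_expansion D A U X T \<longleftrightarrow>
     (\<exists>S R \<beta>. T \<subseteq> S \<and> S \<subseteq> X \<and> R \<subseteq> arcs D \<and>
        expansion A U (D\<lparr>verts := S, arcs := R\<rparr>) \<beta> \<and> bij_betw \<beta> T U)"

lemma card_tips: "tipped_expansion D A U X T \<Longrightarrow> card T = card U"
  by (auto simp: tipped_expansion_def dest: bij_betw_same_card)

lemma tipped_expansion_mono:
  "tipped_expansion D A U X T \<Longrightarrow> X \<subseteq> Y \<Longrightarrow> tipped_expansion D A U Y T"
  unfolding tipped_expansion_def by (meson subset_trans)

lemma tipped_expansion_empty: "tipped_expansion D A {} X {}"
  unfolding tipped_expansion_def
  by (intro exI[of _ "{}"] exI conjI expansion_empty) (auto simp: bij_betw_def)

lemma tipped_expansion_move_tip: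
  assumes "tipped_expansion D A U X T" "x \<in> T" "(x, v) \<in> arcs_ends D" "v \<notin> X"
  shows "tipped_expansion D A U (insert v X) (insert v (T - {x}))"
proof -
  obtain S R \<beta> where H: "T \<subseteq> S" "S \<subseteq> X" "R \<subseteq> arcs D"
      "expansion A U (D\<lparr>verts := S, arcs := R\<rparr>) \<beta>" "bij_betw \<beta> T U"
    using assms(1) by (auto simp: tipped_expansion_def)
  obtain a where a: "a \<in> arcs D" "tail D a = x" "head D a = v"
    using assms(3) by (auto simp: arcs_ends_conv)
  have U: "\<beta> x \<in> U" using H(5) assms(2) by (auto simp: bij_betw_def)
  have "expansion A (insert (\<beta> x) U) (D\<lparr>verts := insert v S, arcs := {a} \<union> R\<rparr>) (\<beta>(v := \<beta> x))"
    using a H assms U by (intro expansion_add_vert) auto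
  moreover have "bij_betw (\<beta>(v := \<beta> x)) (insert v (T - {x})) U"
    using H assms(2,4) U by (auto simp: bij_betw_def inj_on_def image_iff)
  ultimately show ?thesis
    unfolding tipped_expansion_def insert_absorb[OF U] using H a(1)
    by (intro exI[of _ "insert v S"] exI[of _ "insert a R"] exI[of _ "\<beta>(v := \<beta> x)"]) auto
qed

lemma bij_betw_add_tip:
  assumes "bij_betw \<beta> T U" "v \<notin> T" "g \<notin> U"
  shows "bij_betw (\<beta>(v := g)) (insert v T) (insert g U)"
proof -
  have "bij_betw (\<beta>(v := g)) T U"
    using assms(1,2) bij_betw_cong[of T "\<beta>(v := g)" \<beta>] by (metis fun_upd_other)
  with assms(2,3) show ?thesis
    using notIn_Un_bij_betw[of v T "\<beta>(v := g)" U] by simp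
qed

lemma tipped_expansion_new_root:
  assumes "tipped_expansion D A U X T" "v \<notin> X" "g \<notin> U"
    and "\<And>f. f \<in> insert g U \<Longrightarrow> (f, g) \<notin> A \<and> (g, f) \<notin> A"
  shows "tipped_expansion D A (insert g U) (insert v X) (insert v T)"
proof -
  obtain S R \<beta> where H: "T \<subseteq> S" "S \<subseteq> X" "R \<subseteq> arcs D"
      "expansion A U (D\<lparr>verts := S, arcs := R\<rparr>) \<beta>" "bij_betw \<beta> T U"
    using assms(1) by (auto simp: tipped_expansion_def)
  have "expansion A (insert g U) (D\<lparr>verts := insert v S, arcs := {} \<union> R\<rparr>) (\<beta>(v := g))"
    using H assms by (intro expansion_add_vert) auto
  moreover have "bij_betw (\<beta>(v := g)) (insert v T) (insert g U)"
    using H assms by (intro bij_betw_add_tip) auto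
  ultimately show ?thesis
    unfolding tipped_expansion_def using H
    by (intro exI[of _ "insert v S"] exI[of _ R] exI[of _ "\<beta>(v := g)"]) auto
qed

text \<open>
  The tip \<open>x\<close> of the parent depends on the labelling, which \<^const>\<open>tipped_expansion\<close> hides. Therefore
  \<open>x\<close> is obtained first and the arc \<open>(x, v)\<close> may be chosen afterwards.
\<close>

lemma tipped_expansion_new_child:
  assumes "tipped_expansion D A U X T" "p \<in> U" "(p, g) \<in> A" "g \<notin> U"
    and "\<And>f. f \<in> insert g U \<Longrightarrow> ((f, g) \<in> A \<longrightarrow> f = p) \<and> (g, f) \<notin> A"
  obtains x where "x \<in> T" "\<And>v. (x, v) \<in> arcs_ends D \<Longrightarrow> v \<notin> X \<Longrightarrow>
    tipped_expansion D A (insert g U) (insert v X) (insert v T)"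
proof -
  obtain S R \<beta> where H: "T \<subseteq> S" "S \<subseteq> X" "R \<subseteq> arcs D"
      "expansion A U (D\<lparr>verts := S, arcs := R\<rparr>) \<beta>" "bij_betw \<beta> T U"
    using assms(1) by (auto simp: tipped_expansion_def)
  obtain x where x: "x \<in> T" "\<beta> x = p"
    using H(5) assms(2) by (auto simp: bij_betw_def)
  show thesis
  proof (rule that[OF x(1)])
    fix v assume v: "(x, v) \<in> arcs_ends D" "v \<notin> X"
    then obtain a where a: "a \<in> arcs D" "tail D a = x" "head D a = v"
      by (auto simp: arcs_ends_conv)
    have "expansion A (insert g U) (D\<lparr>verts := insert v S, arcs := {a} \<union> R\<rparr>) (\<beta>(v := g))"
      using a H v x assms by (intro expansion_add_vert) auto
    moreover have "bij_betw (\<beta>(v := g)) (insert v T) (insert g U)"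
      using H assms v by (intro bij_betw_add_tip) auto
    ultimately show "tipped_expansion D A (insert g U) (insert v X) (insert v T)"
      unfolding tipped_expansion_def using H a(1)
      by (intro exI[of _ "insert v S"] exI[of _ "insert a R"] exI[of _ "\<beta>(v := g)"]) auto
  qed
qed

section \<open>Moving the tips\<close>

text \<open>
  This is Menger's theorem, applied directly to expansions instead of to systems of disjoint paths: if
  no set between \<open>X\<close> and \<open>Z\<close> has a smaller boundary than \<open>X\<close>, then the tips can be moved along
  disjoint paths from the boundary of \<open>X\<close> into that of \<open>Z\<close>. If a set strictly between \<open>X\<close> and \<open>Z\<close> has
  a boundary of the same size as \<open>X\<close>, the movement is composed of two shorter ones. Otherwise all
  these boundaries are larger than that of \<open>X\<close>, so there is one vertex to spare: a tip \<open>x\<close> is moved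
  along an arbitrary arc to some \<open>v\<close> outside \<open>X\<close>, and deleting all arcs that leave \<open>x\<close> removes \<open>x\<close>
  from the boundaries without destroying the hypothesis. The relation \<open>E\<close> is separate from
  \<open>arcs_ends D\<close> to make room for these deletions.
\<close>

lemma tipped_expansion_linkage:
  assumes "finite Z" "X \<subseteq> Z" "E \<subseteq> arcs_ends D"
    and "\<And>Y. X \<subseteq> Y \<Longrightarrow> Y \<subseteq> Z \<Longrightarrow> card (out_boundary E X) \<le> card (out_boundary E Y)"
    and "tipped_expansion D A U X (out_boundary E X)"
  shows "\<exists>T \<subseteq> out_boundary E Z. tipped_expansion D A U Z T"
  using assms
proof (induction "card (Z - X)" arbitrary: E X Z rule: less_induct)
  case less
  note fin = \<open>finite Z\<close> and XZ = \<open>X \<subseteq> Z\<close> and E = \<open>E \<subseteq> arcs_ends D\<close>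
    and sep = less.prems(4) and tipped = less.prems(5)
  let ?b = "out_boundary E"
  have finb: "finite (?b Y)" if "Y \<subseteq> Z" for Y
    using that fin finite_subset finite_out_boundary by metis
  consider (arrived) "?b X \<subseteq> ?b Z"
    | (split) Y where "X \<subset> Y" "Y \<subset> Z" "card (?b Y) = card (?b X)"
    | (tight) x where "x \<in> ?b X" "x \<notin> ?b Z"
        "\<And>Y. X \<subset> Y \<Longrightarrow> Y \<subset> Z \<Longrightarrow> card (?b X) < card (?b Y)"
  proof (cases "?b X \<subseteq> ?b Z \<or> (\<exists>Y. X \<subset> Y \<and> Y \<subset> Z \<and> card (?b Y) = card (?b X))")
    case False
    then obtain x where "x \<in> ?b X" "x \<notin> ?b Z" by auto
    moreover have "card (?b X) < card (?b Y)" if "X \<subset> Y" "Y \<subset> Z" for Y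
      using sep[of Y] that False by (metis le_neq_implies_less psubset_imp_subset)
    ultimately show ?thesis using tight by blast
  qed (use arrived split in blast)
  then show ?case
  proof cases
    case arrived
    with tipped_expansion_mono[OF tipped XZ] show ?thesis by blast
  next
    case (split Y)
    have finY: "finite Y" using split fin finite_subset by auto
    have smaller: "card (Y - X) < card (Z - X)" "card (Z - Y) < card (Z - X)"
      using split XZ fin by (auto intro!: psubset_card_mono)
    obtain T where T: "T \<subseteq> ?b Y" "tipped_expansion D A U Y T"
      using less.hyps[OF smaller(1) finY _ E _ tipped] split sep by auto
    have "card T = card (?b Y)"
      using card_tips[OF T(2)] card_tips[OF tipped] split(3) by simp
    then have "T = ?b Y" using T(1) finb split(2) by (intro card_subset_eq) auto
    with T less.hyps[OF smaller(2) fin _ E] split sep show ?thesis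
      by (metis psubset_imp_subset subset_trans)
  next
    case (tight x)
    from tight(1,2) XZ obtain v where v: "(x, v) \<in> E" "v \<notin> X" "v \<in> Z" and x: "x \<in> X"
      by (auto simp: out_boundary_def)
    \<comment> \<open>Nothing is lost at \<open>Z\<close> itself, because \<open>x\<close> is not in the boundary of \<open>Z\<close>.\<close>
    let ?X = "insert v X" and ?E = "E - {x} \<times> UNIV"
    let ?b' = "out_boundary ?E"
    have b': "?b' Y = ?b Y - {x}" for Y by (auto simp: out_boundary_def)
    have xb: "x \<in> ?b X" and xZ: "x \<notin> ?b Z" by fact+
    have card_X: "card (?b X - {x}) = card (?b X) - 1" "0 < card (?b X)"
      using xb finb[OF XZ] by (auto simp: card_gt_0_iff)
    have vb: "v \<notin> ?b X" "v \<noteq> x" using v(2) x by (auto simp: out_boundary_def)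
    have large: "card (?b X) \<le> card (?b' Y)" if "?X \<subseteq> Y" "Y \<subseteq> Z" for Y
    proof (cases "Y = Z")
      case True
      then show ?thesis using sep[of Z] xZ XZ by (simp add: b')
    next
      case False
      then have "card (?b X) < card (?b Y)" using tight(3) that v by blast
      then show ?thesis unfolding b' using finb[OF that(2)] by (auto simp: card_Diff_singleton_if)
    qed
    have X': "?b' ?X = insert v (?b X - {x})"
    proof (rule card_seteq)
      show "finite (insert v (?b X - {x}))" using finb[OF XZ] by simp
      show "?b' ?X \<subseteq> insert v (?b X - {x})" using out_boundary_insert[of E v X] by (auto simp: b')
      show "card (insert v (?b X - {x})) \<le> card (?b' ?X)"
        using large[of ?X] v XZ card_X vb finb[OF XZ] by simp
    qed
    have card': "card (?b' ?X) = card (?b X)"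
      using X' card_X vb finb[OF XZ] by simp
    have "card (Z - ?X) < card (Z - X)"
      using v fin by (intro psubset_card_mono) auto
    moreover have "tipped_expansion D A U ?X (?b' ?X)"
      unfolding X' using tipped xb v E by (intro tipped_expansion_move_tip) auto
    ultimately have "\<exists>T \<subseteq> ?b' Z. tipped_expansion D A U Z T"
      using fin XZ v(3) E large by (intro less.hyps[of Z ?X ?E]) (auto simp only: card' insert_subset)
    then show ?thesis unfolding b' by blast
  qed
qed

section \<open>Contracting an expansion\<close>

lemma has_butterfly_minor_trans:
  assumes "has_butterfly_minor D H" "has_butterfly_minor H K"
  shows "has_butterfly_minor D K"
  using assms(2,1) by induction (blast intro: has_butterfly_minor.intros)+

lemma has_butterfly_minor_del_arcs:
  assumes "finite B" "B \<subseteq> arcs D"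
  shows "has_butterfly_minor D (D\<lparr>arcs := arcs D - B\<rparr>)"
  using assms
proof induction
  case empty
  show ?case by (simp add: has_butterfly_minor.refl)
next
  case (insert b B)
  then have "has_butterfly_minor D (pre_digraph.del_arc (D\<lparr>arcs := arcs D - B\<rparr>) b)"
    by (intro has_butterfly_minor.del_arc) auto
  also have "pre_digraph.del_arc (D\<lparr>arcs := arcs D - B\<rparr>) b = D\<lparr>arcs := arcs D - insert b B\<rparr>"
    by (rule pre_digraph.equality) (auto simp: pre_digraph.del_arc_def)
  finally show ?case .
qed

lemma has_butterfly_minor_del_isolated_verts:
  assumes "finite C" "C \<subseteq> verts D" "\<And>a. a \<in> arcs D \<Longrightarrow> tail D a \<notin> C \<and> head D a \<notin> C"
  shows "has_butterfly_minor D (D\<lparr>verts := verts D - C\<rparr>)"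
  using assms
proof induction
  case empty
  show ?case by (simp add: has_butterfly_minor.refl)
next
  case (insert v C)
  then have "has_butterfly_minor D (pre_digraph.del_vert (D\<lparr>verts := verts D - C\<rparr>) v)"
    by (intro has_butterfly_minor.del_vert) auto
  also have "pre_digraph.del_vert (D\<lparr>verts := verts D - C\<rparr>) v = D\<lparr>verts := verts D - insert v C\<rparr>"
    using insert.prems by (intro pre_digraph.equality) (auto simp: pre_digraph.del_vert_def)
  finally show ?case .
qed

text \<open>
  The arcs are deleted first: afterwards the superfluous vertices are isolated, and deleting them leaves
  the set of arcs unchanged.
\<close>

lemma has_butterfly_minor_subgraph:
  assumes "fin_digraph D" "S \<subseteq> verts D" "R \<subseteq> arcs D" "wf_digraph (D\<lparr>verts := S, arcs := R\<rparr>)"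
  shows "has_butterfly_minor D (D\<lparr>verts := S, arcs := R\<rparr>)"
proof -
  interpret fin_digraph D by fact
  have ends: "tail D a \<in> S" "head D a \<in> S" if "a \<in> R" for a
    using assms(4) that by (auto simp: wf_digraph_def)
  have "has_butterfly_minor D (D\<lparr>arcs := arcs D - (arcs D - R)\<rparr>)"
    by (rule has_butterfly_minor_del_arcs) auto
  also have "arcs D - (arcs D - R) = R" using assms(3) by blast
  finally have 1: "has_butterfly_minor D (D\<lparr>arcs := R\<rparr>)" .
  have "has_butterfly_minor (D\<lparr>arcs := R\<rparr>)
      (D\<lparr>arcs := R, verts := verts (D\<lparr>arcs := R\<rparr>) - (verts D - S)\<rparr>)"
    by (rule has_butterfly_minor_del_isolated_verts) (auto dest: ends)
  also have "D\<lparr>arcs := R, verts := verts (D\<lparr>arcs := R\<rparr>) - (verts D - S)\<rparr>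
      = D\<lparr>verts := S, arcs := R\<rparr>"
    using assms(2) by (intro pre_digraph.equality) (auto simp: double_diff)
  finally show ?thesis using 1 by (rule has_butterfly_minor_trans[rotated])
qed

text \<open>
  The head of \<open>e\<close> has in-degree one and is not the root of its branch set. Merging it into the tail
  of \<open>e\<close> keeps the heads of all other arcs and only changes tails within a branch set. Tails only
  move down in rank, so the old rank still works.
\<close>

lemma expansion_contract_arc:
  assumes exp: "expansion A U H \<beta>" and irrefl: "\<And>f. (f, f) \<notin> A"
    and e: "e \<in> arcs H" "\<beta> (tail H e) = \<beta> (head H e)"
  shows "contractible_arc H e" and "expansion A U (contract_arc H e) \<beta>"
proof -
  let ?K = "contract_arc H e" and ?u = "tail H e" and ?v = "head H e"
  have inj: "a = b" if "a \<in> arcs H" "b \<in> arcs H" "head H a = head H b" for a b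
    using exp that by (auto simp: expansion_def dest: inj_onD)
  have wf: "tail H a \<in> verts H" "head H a \<in> verts H" if "a \<in> arcs H" for a
    using exp that by (auto simp: expansion_def wf_digraph_def)
  obtain \<rho> :: "_ \<Rightarrow> nat" where \<rho>: "\<And>a. a \<in> arcs H \<Longrightarrow> \<rho> (tail H a) < \<rho> (head H a)"
    using exp by (auto simp: expansion_def)
  have uv: "?u \<noteq> ?v" using \<rho>[OF e(1)] by auto
  have "in_arcs H ?v = {e}" using inj e(1) by (auto simp: in_arcs_def)
  then show "contractible_arc H e"
    using e(1) by (simp add: contractible_arc_def in_degree_def)
  have verts: "verts ?K = verts H - {?v}"
    using wf[OF e(1)] uv by (auto simp: contract_arc_def Let_def)
  have arcs: "arcs ?K = arcs H - {e}"
    by (simp add: contract_arc_def Let_def)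
  have head: "head ?K a = head H a" "head H a \<noteq> ?v" if "a \<in> arcs ?K" for a
    using that inj[OF _ e(1)] unfolding arcs by (auto simp: contract_arc_def Let_def)
  have tail: "tail ?K a = (if tail H a = ?v then ?u else tail H a)" for a
    by (simp add: contract_arc_def Let_def)
  have \<beta>: "\<beta> (tail ?K a) = \<beta> (tail H a)" for a
    using e(2) by (simp add: tail)
  have 1: "wf_digraph ?K"
    using wf head uv e(1) by (auto simp: wf_digraph_def verts tail arcs)
  have 2: "inj_on (head ?K) (arcs ?K)"
    using inj head by (auto simp: inj_on_def arcs)
  have 3: "\<exists>\<rho> :: _ \<Rightarrow> nat. \<forall>a \<in> arcs ?K. \<rho> (tail ?K a) < \<rho> (head ?K a)"
  proof (intro exI ballI)
    fix a assume a: "a \<in> arcs ?K"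
    then have "\<rho> (tail H a) < \<rho> (head ?K a)" using \<rho>[of a] head(1)[OF a] by (simp add: arcs)
    then show "\<rho> (tail ?K a) < \<rho> (head ?K a)" using \<rho>[OF e(1)] by (auto simp: tail)
  qed
  have 4: "\<beta> ` verts ?K \<subseteq> U"
    using exp by (auto simp: expansion_def verts)
  have 5: "\<beta> (tail ?K a) = \<beta> (head ?K a) \<or> (\<beta> (tail ?K a), \<beta> (head ?K a)) \<in> A" if "a \<in> arcs ?K" for a
    unfolding \<beta> head(1)[OF that] using exp that by (simp add: expansion_def arcs)
  have 6: "\<exists>!y. y \<in> verts ?K \<and> \<beta> y = f \<and> (\<forall>a \<in> arcs ?K. head ?K a = y \<longrightarrow> \<beta> (tail ?K a) \<noteq> f)"
    if "f \<in> U" for f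
  proof -
    have "(y \<in> verts ?K \<and> \<beta> y = f \<and> (\<forall>a \<in> arcs ?K. head ?K a = y \<longrightarrow> \<beta> (tail ?K a) \<noteq> f)) \<longleftrightarrow>
      (y \<in> verts H \<and> \<beta> y = f \<and> (\<forall>a \<in> arcs H. head H a = y \<longrightarrow> \<beta> (tail H a) \<noteq> f))" for y
    proof (cases "y = ?v")
      case True
      with e show ?thesis by (auto simp: verts)
    next
      case False
      then have "(\<forall>a \<in> arcs ?K. head ?K a = y \<longrightarrow> \<beta> (tail ?K a) \<noteq> f) \<longleftrightarrow>
        (\<forall>a \<in> arcs H. head H a = y \<longrightarrow> \<beta> (tail H a) \<noteq> f)"
        using head(1) by (auto simp: \<beta> arcs)
      with False show ?thesis by (simp add: verts)
    qed
    with exp that show ?thesis by (simp add: expansion_def)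
  qed
  have 7: "\<exists>a \<in> arcs ?K. \<beta> (tail ?K a) = f \<and> \<beta> (head ?K a) = g"
    if fg: "f \<in> U" "g \<in> U" "(f, g) \<in> A" for f g
  proof -
    from exp fg have "\<exists>a \<in> arcs H. \<beta> (tail H a) = f \<and> \<beta> (head H a) = g"
      by (simp add: expansion_def)
    then obtain a where a: "a \<in> arcs H" "\<beta> (tail H a) = f" "\<beta> (head H a) = g" by blast
    with e(2) fg(3) irrefl have "a \<in> arcs ?K" by (auto simp: arcs)
    with a head(1) \<beta> show ?thesis by auto
  qed
  show "expansion A U ?K \<beta>"
    unfolding expansion_def by (intro conjI ballI impI 1 2 3 4 5 6 7)
qed

text \<open>
  Without arcs inside the branch sets every vertex is the root of its branch set, so the branch sets
  are singletons and the labelling is the isomorphism. As in-degrees are at most one, no two arcs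
  represent the same arc of \<open>F\<close>.
\<close>

lemma digraph_iso_if_expansion_without_inner_arcs:
  assumes exp: "expansion (arcs_ends F) (verts F) H \<beta>"
    and inner: "\<And>a. a \<in> arcs H \<Longrightarrow> \<beta> (tail H a) \<noteq> \<beta> (head H a)"
    and F: "nomulti_digraph F"
  shows "digraph_iso H F"
proof -
  interpret F: nomulti_digraph F by fact
  define \<gamma> where "\<gamma> a = the_inv_into (arcs F) (arc_to_ends F) (\<beta> (tail H a), \<beta> (head H a))" for a
  have wf: "tail H a \<in> verts H" "head H a \<in> verts H" if "a \<in> arcs H" for a
    using exp that by (auto simp: expansion_def wf_digraph_def)
  have root: "\<exists>!y. y \<in> verts H \<and> \<beta> y = f" if "f \<in> verts F" for f
  proof -
    have ex1: "\<exists>!y. y \<in> verts H \<and> \<beta> y = f \<and> (\<forall>a \<in> arcs H. head H a = y \<longrightarrow> \<beta> (tail H a) \<noteq> f)"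
      using exp that by (simp add: expansion_def)
    have "\<forall>a \<in> arcs H. head H a = y \<longrightarrow> \<beta> (tail H a) \<noteq> f" if "\<beta> y = f" for y
      using inner that by auto
    with ex1 show ?thesis by (elim ex1E) (rule ex1I; blast)
  qed
  have \<beta>F: "\<beta> y \<in> verts F" if "y \<in> verts H" for y
    using exp that by (auto simp: expansion_def)
  have inj: "inj_on \<beta> (verts H)"
    using root[OF \<beta>F] by (metis inj_onI)
  have \<beta>: "\<beta> ` verts H = verts F"
  proof
    show "verts F \<subseteq> \<beta> ` verts H" using root by (metis image_eqI subsetI)
  qed (use \<beta>F in blast)
  have arc: "\<gamma> a \<in> arcs F" "tail F (\<gamma> a) = \<beta> (tail H a)" "head F (\<gamma> a) = \<beta> (head H a)"
    if "a \<in> arcs H" for a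
  proof -
    have "(\<beta> (tail H a), \<beta> (head H a)) \<in> arc_to_ends F ` arcs F"
      using exp inner that by (auto simp: expansion_def arcs_ends_def)
    then obtain c where c: "c \<in> arcs F" "(\<beta> (tail H a), \<beta> (head H a)) = arc_to_ends F c"
      by blast
    then have "\<gamma> a = c"
      unfolding \<gamma>_def by (simp add: the_inv_into_f_f F.inj_on_arc_to_ends)
    with c show "\<gamma> a \<in> arcs F" "tail F (\<gamma> a) = \<beta> (tail H a)" "head F (\<gamma> a) = \<beta> (head H a)"
      by (auto simp: arc_to_ends_def)
  qed
  have "inj_on \<gamma> (arcs H)"
  proof (rule inj_onI)
    fix a b assume ab: "a \<in> arcs H" "b \<in> arcs H" "\<gamma> a = \<gamma> b"
    then have "\<beta> (head H a) = \<beta> (head H b)" using arc(3) by metis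
    then have "head H a = head H b" using inj wf(2) ab by (auto dest: inj_onD)
    with exp ab show "a = b" by (auto simp: expansion_def dest: inj_onD)
  qed
  moreover have "\<gamma> ` arcs H = arcs F"
  proof
    show "arcs F \<subseteq> \<gamma> ` arcs H"
    proof
      fix c assume c: "c \<in> arcs F"
      then have "(tail F c, head F c) \<in> arcs_ends F" by (rule F.in_arcs_imp_in_arcs_ends)
      with exp F.wellformed[OF c] have "\<exists>a \<in> arcs H. \<beta> (tail H a) = tail F c \<and> \<beta> (head H a) = head F c"
        by (simp add: expansion_def)
      then obtain a where a: "a \<in> arcs H" "\<beta> (tail H a) = tail F c" "\<beta> (head H a) = head F c"
        by blast
      with arc[OF a(1)] c have "\<gamma> a = c" by (intro F.no_multi_arcs) (auto simp: arc_to_ends_def)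
      with a(1) show "c \<in> \<gamma> ` arcs H" by blast
    qed
  qed (use arc in auto)
  moreover have "wf_digraph H" using exp by (simp add: expansion_def)
  ultimately show ?thesis
    unfolding digraph_iso_def using inj \<beta> arc(2,3)
    by (intro exI[of _ "\<lparr>iso_verts = \<beta>, iso_arcs = \<gamma>, iso_head = head F, iso_tail = tail F\<rparr>"])
      (auto simp: pre_digraph.digraph_isomorphism_def app_iso_def)
qed

lemma butterfly_minor_if_expansion:
  assumes "finite (arcs H)" "expansion (arcs_ends F) (verts F) H \<beta>" "nomulti_digraph F"
    and irrefl: "\<And>f. (f, f) \<notin> arcs_ends F"
  shows "\<exists>K. has_butterfly_minor H K \<and> digraph_iso K F"
  using assms(1,2)
proof (induction "card (arcs H)" arbitrary: H rule: less_induct)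
  case less
  show ?case
  proof (cases "\<exists>e \<in> arcs H. \<beta> (tail H e) = \<beta> (head H e)")
    case False
    then have "digraph_iso H F"
      using less.prems(2) assms(3) by (intro digraph_iso_if_expansion_without_inner_arcs) auto
    then show ?thesis using has_butterfly_minor.refl by blast
  next
    case True
    then obtain e where e: "e \<in> arcs H" "\<beta> (tail H e) = \<beta> (head H e)" by blast
    have arcs: "arcs (contract_arc H e) = arcs H - {e}"
      by (simp add: contract_arc_def Let_def)
    have "card (arcs (contract_arc H e)) < card (arcs H)"
      unfolding arcs using e(1) less.prems(1) by (rule card_Diff1_less[rotated])
    then obtain K where "has_butterfly_minor (contract_arc H e) K" "digraph_iso K F"
      using less.hyps[OF _ _ expansion_contract_arc(2)[OF less.prems(2) irrefl e]] less.prems(1)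
      unfolding arcs by blast
    moreover have "has_butterfly_minor H (contract_arc H e)"
      using expansion_contract_arc(1)[OF less.prems(2) irrefl e]
      by (intro has_butterfly_minor.contract has_butterfly_minor.refl)
    ultimately show ?thesis using has_butterfly_minor_trans by blast
  qed
qed

section \<open>Forests of arborescences\<close>

text \<open>
  Two paths from \<open>u\<close> to \<open>v\<close> that leave \<open>u\<close> by different edges show that the two neighbours of \<open>u\<close> on
  them are joined by a path avoiding \<open>u\<close>, which closes up to a cycle through \<open>u\<close> of length at least
  three. Paths with a common first edge are compared after removing it.
\<close>

lemma undirected_tree_apath_unique:
  assumes "undirected_tree T" "pre_digraph.apath (with_proj T) u p v" "pre_digraph.apath (with_proj T) u q v"
  shows "p = q"
proof -
  let ?T = "with_proj T"
  interpret sym_digraph ?T using assms(1) by (simp add: undirected_tree_def)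
  have acyclic: "\<not> (cycle r \<and> length r \<ge> 3)" for r
    using assms(1) by (simp add: undirected_tree_def)
  show ?thesis
    using assms(2,3)
  proof (induction p arbitrary: u q)
    case Nil
    then have "u = v" by (simp add: apath_Nil_iff)
    with Nil.prems(2) show ?case using apath_nonempty_ends by blast
  next
    case (Cons e p)
    then have "u \<noteq> v" using apath_nonempty_ends by blast
    then obtain e' q' where q: "q = e' # q'" using Cons.prems(2) by (cases q) (auto simp: apath_Nil_iff)
    let ?w = "snd e" and ?w' = "snd e'"
    have e: "e \<in> parcs T" "fst e = u" "apath ?w p v" "u \<notin> set (awalk_verts ?w p)"
      using Cons.prems(1) by (auto simp: apath_Cons_iff)
    have e': "e' \<in> parcs T" "fst e' = u" "apath ?w' q' v" "u \<notin> set (awalk_verts ?w' q')"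
      using Cons.prems(2) unfolding q by (auto simp: apath_Cons_iff)
    show ?case
    proof (cases "?w = ?w'")
      case True
      then have "e = e'" using e(2) e'(2) by (simp add: prod_eq_iff)
      with Cons.IH[OF e(3), of q'] e'(3) q show ?thesis by simp
    next
      case False
      define G where "G = ?T \<restriction> (pverts T - {u})"
      have ind: "induced_subgraph G ?T" unfolding G_def by (intro induced_induce) auto
      interpret G: wf_digraph G unfolding G_def by (rule wellformed_induce_subgraph)
      have symG: "symmetric G" using induced_graph_imp_symmetric[OF sym_arcs ind] .
      have reach: "x \<rightarrow>\<^sup>*\<^bsub>G\<^esub> v" if "apath x r v" "u \<notin> set (awalk_verts x r)" for x r
      proof -
        have "awalk x r v" using that(1) by (rule awalkI_apath)
        moreover from this have "set (awalk_verts x r) \<subseteq> pverts T - {u}"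
          using that(2) awalkE' by fastforce
        ultimately have "G.awalk x r v" unfolding G_def by (rule awalk_induce)
        then show ?thesis by (rule G.reachable_awalkI)
      qed
      have "?w \<rightarrow>\<^sup>*\<^bsub>G\<^esub> ?w'"
        using reach[OF e(3,4)] symmetric_reachable[OF symG reach[OF e'(3,4)]]
        by (rule G.reachable_trans)
      then obtain r where r: "G.apath ?w r ?w'" using G.reachable_apath by blast
      have "apath ?w r ?w'"
        using subgraph_apath_imp_apath[OF r induced_imp_subgraph[OF ind]] .
      have r_verts: "set (awalk_verts ?w r) \<subseteq> pverts T - {u}"
      proof -
        have "set (G.awalk_verts ?w r) \<subseteq> verts G"
          using G.awalkI_apath[OF r] unfolding G.awalk_conv by (rule conjunct1)
        then show ?thesis unfolding G_def awalk_verts_induce by simp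
      qed
      let ?c = "e # r @ [(?w', u)]"
      have "(?w', u) \<in> parcs T"
        using graph_symmetric[of u ?w'] e'(1,2) by (metis prod.collapse with_proj_simps(3))
      have r_walk: "awalk ?w (r @ [(?w', u)]) u"
        using awalkI_apath[OF \<open>apath ?w r ?w'\<close>] arc_implies_awalk \<open>(?w', u) \<in> parcs T\<close>
        by (intro awalk_appendI) auto
      have "awalk u ?c u"
        using e(1,2) r_walk by (simp add: awalk_Cons_iff del: awalk_append_iff)
      moreover have "distinct (tl (awalk_verts u ?c))"
        using awalk_verts_append[OF r_walk] \<open>apath ?w r ?w'\<close> r_verts by (auto simp: apath_def)
      ultimately have "cycle ?c" unfolding cycle_def by blast
      moreover have "length ?c \<ge> 3"
        using \<open>apath ?w r ?w'\<close> False by (cases r) (auto simp: apath_Nil_iff)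
      ultimately show ?thesis using acyclic by blast
    qed
  qed
qed

text \<open>
  The rank of a vertex is its distance from the root, that is, the length of the only path to it.
\<close>

lemma arborescence_parent_unique_and_ranked:
  fixes G :: "('a, 'b) pre_digraph"
  assumes "arborescence G"
  shows "\<exists>d :: 'a \<Rightarrow> nat. \<forall>(x, y) \<in> arcs_ends G. d x < d y"
    and "(x, y) \<in> arcs_ends G \<Longrightarrow> (x', y) \<in> arcs_ends G \<Longrightarrow> x = x'"
proof -
  obtain T u where T: "undirected_tree T"
    and arcs: "arcs_ends G = {(x, y). \<exists>p. pre_digraph.apath (with_proj T) u (p @ [(x, y)]) y}"
    using assms by (auto simp: arborescence_def)
  interpret sym_digraph "with_proj T" using T by (simp add: undirected_tree_def)
  note uniq = undirected_tree_apath_unique[OF T]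
  define d where "d y = length (THE p. apath u p y)" for y
  have d: "d y = length p" if "apath u p y" for p y
    using the_equality[of "\<lambda>p. apath u p y" p] that uniq by (metis d_def)
  have "d x < d y" if "(x, y) \<in> arcs_ends G" for x y
  proof -
    from that obtain p where p: "apath u (p @ [(x, y)]) y" by (auto simp: arcs)
    then have "apath u p x" by (auto simp: apath_append_iff apath_Cons_iff)
    with d[OF this] d[OF p] show ?thesis by simp
  qed
  then show "\<exists>d :: 'a \<Rightarrow> nat. \<forall>(x, y) \<in> arcs_ends G. d x < d y" by blast
  show "x = x'" if "(x, y) \<in> arcs_ends G" "(x', y) \<in> arcs_ends G"
    using that uniq by (fastforce simp: arcs)
qed

definition weak_component :: "('a, 'b) pre_digraph \<Rightarrow> 'a \<Rightarrow> ('a, 'b) pre_digraph" where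
  "weak_component G x = G \<restriction> {v. x \<rightarrow>\<^sup>*\<^bsub>with_proj (mk_symmetric G)\<^esub> v}"

context wf_digraph begin

lemma max_subgraph_weak_component:
  assumes x: "x \<in> verts G"
  shows "max_subgraph connected (weak_component G x)"
proof -
  interpret S: pair_wf_digraph "mk_symmetric G" by (rule wellformed_mk_symmetric)
  let ?M = "with_proj (mk_symmetric G)" and ?H = "weak_component G x"
  let ?C = "{v. x \<rightarrow>\<^sup>*\<^bsub>?M\<^esub> v}"
  have C: "?C \<subseteq> verts G" using S.reachable_in_verts(2) by auto
  have xC: "x \<in> ?C" using x by auto
  have sub: "subgraph ?H G"
    unfolding weak_component_def using C by (rule subgraph_induce_subgraphI)
  interpret H: wf_digraph ?H using sub by (auto simp: subgraph_def)
  interpret SH: pair_wf_digraph "mk_symmetric ?H" by (rule H.wellformed_mk_symmetric)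
  have eq: "reachable (with_proj (mk_symmetric ?H)) = reachable (?M \<restriction> ?C)"
  proof -
    have "arcs_ends (with_proj (mk_symmetric ?H)) = arcs_ends (?M \<restriction> ?C)"
      by (auto simp: weak_component_def mk_symmetric_def arcs_ends_conv)
    moreover have "verts (with_proj (mk_symmetric ?H)) = verts (?M \<restriction> ?C)"
      by (auto simp: weak_component_def)
    ultimately show ?thesis by (simp add: reachable_def fun_eq_iff)
  qed
  have reach: "x \<rightarrow>\<^sup>*\<^bsub>with_proj (mk_symmetric ?H)\<^esub> v" if "v \<in> ?C" for v
    unfolding eq using S.induce_reachable_preserves_paths that by simp
  have "connected ?H"
    unfolding connected_def
  proof
    show "verts (with_proj (mk_symmetric ?H)) \<noteq> {}"
      using xC by (auto simp: weak_component_def)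
    fix v w assume "v \<in> verts (with_proj (mk_symmetric ?H))" "w \<in> verts (with_proj (mk_symmetric ?H))"
    then have "v \<in> ?C" "w \<in> ?C" by (auto simp: weak_component_def)
    with reach show "v \<rightarrow>\<^sup>*\<^bsub>with_proj (mk_symmetric ?H)\<^esub> w"
      using SH.reachable_trans symmetric_reachable[OF symmetric_mk_symmetric] by metis
  qed
  moreover have "H' = ?H" if H': "subgraph ?H H'" "subgraph H' G" "connected H'" for H'
  proof -
    have "verts H' \<subseteq> ?C"
    proof
      fix v assume v: "v \<in> verts H'"
      have "x \<in> verts H'" using H'(1) xC by (auto simp: subgraph_def weak_component_def)
      with v H'(3) have "x \<rightarrow>\<^sup>*\<^bsub>with_proj (mk_symmetric H')\<^esub> v"
        by (auto simp: connected_def strongly_connected_def)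
      with S.reachable_mono[OF this subgraph_mk_symmetric[OF H'(2)]] show "v \<in> ?C" by simp
    qed
    then have "arcs H' \<subseteq> arcs ?H"
      using H'(2) by (auto simp: subgraph_def compatible_def weak_component_def wf_digraph_def)
    with \<open>verts H' \<subseteq> ?C\<close> H'(1) show ?thesis
      by (intro pre_digraph.equality) (auto simp: subgraph_def compatible_def weak_component_def)
  qed
  ultimately show ?thesis using sub by (auto simp: max_subgraph_def)
qed

end

lemma weak_component_eq_if_arc:
  assumes "wf_digraph G" "a \<in> arcs G"
  shows "weak_component G (tail G a) = weak_component G (head G a)"
proof -
  interpret wf_digraph G by fact
  interpret S: pair_wf_digraph "mk_symmetric G" by (rule wellformed_mk_symmetric)
  let ?M = "with_proj (mk_symmetric G)"
  have "(tail G a, head G a) \<in> parcs (mk_symmetric G)" "(head G a, tail G a) \<in> parcs (mk_symmetric G)"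
    using assms(2) by (auto simp: mk_symmetric_def)
  then have "tail G a \<rightarrow>\<^sup>*\<^bsub>?M\<^esub> head G a" "head G a \<rightarrow>\<^sup>*\<^bsub>?M\<^esub> tail G a"
    by (blast intro: S.reachable_adjI)+
  then have "{v. tail G a \<rightarrow>\<^sup>*\<^bsub>?M\<^esub> v} = {v. head G a \<rightarrow>\<^sup>*\<^bsub>?M\<^esub> v}"
    using S.reachable_trans by blast
  then show ?thesis by (simp add: weak_component_def)
qed

text \<open>
  The two ends of an arc have the same weak component, so a rank that is chosen for each component
  separately is a rank for \<open>F\<close>, and two arcs with the same head are compared inside one
  arborescence.
\<close>

lemma forest_of_arborescences_parent_unique_and_ranked:
  fixes F :: "('a, 'b) pre_digraph"
  assumes "forest_of_arborescences F"
  shows "inj_on (head F) (arcs F)"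
    and "\<exists>d :: 'a \<Rightarrow> nat. \<forall>a \<in> arcs F. d (tail F a) < d (head F a)"
proof -
  interpret wf_digraph F using assms by (simp add: forest_of_arborescences_def)
  interpret S: pair_wf_digraph "mk_symmetric F" by (rule wellformed_mk_symmetric)
  let ?H = "weak_component F"
  have arb: "arborescence (?H x)" if "x \<in> verts F" for x
    using assms max_subgraph_weak_component[OF that] by (simp add: forest_of_arborescences_def)
  have ends: "tail (?H x) = tail F" "head (?H x) = head F" for x
    by (simp_all add: weak_component_def)
  have arc: "a \<in> arcs (?H (head F a))" "(tail F a, head F a) \<in> arcs_ends (?H (head F a))"
    if "a \<in> arcs F" for a
  proof -
    have "(head F a, tail F a) \<in> parcs (mk_symmetric F)"
      using that by (auto simp: mk_symmetric_def)
    then have "head F a \<rightarrow>\<^sup>*\<^bsub>with_proj (mk_symmetric F)\<^esub> tail F a"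
      by (rule S.reachable_adjI)
    with that show "a \<in> arcs (?H (head F a))"
      by (auto simp: weak_component_def)
    then show "(tail F a, head F a) \<in> arcs_ends (?H (head F a))"
      by (auto simp: arcs_ends_conv ends)
  qed
  show "inj_on (head F) (arcs F)"
  proof (rule inj_onI)
    fix a b assume ab: "a \<in> arcs F" "b \<in> arcs F" "head F a = head F b"
    let ?K = "?H (head F a)"
    have K: "arborescence ?K" using arb ab(1) by simp
    have "tail F a = tail F b"
      using arborescence_parent_unique_and_ranked(2)[OF K] arc(2)[OF ab(1)] arc(2)[OF ab(2)] ab(3)
      by metis
    moreover have "nomulti_digraph ?K" using K by (simp add: arborescence_def)
    ultimately show "a = b"
      using arc(1)[OF ab(1)] arc(1)[OF ab(2)] ab(3)
      by (intro nomulti_digraph.no_multi_arcs[of ?K]) (simp_all add: arc_to_ends_def ends)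
  qed
  define d where "d x = (SOME d :: 'a \<Rightarrow> nat. \<forall>(y, z) \<in> arcs_ends (?H x). d y < d z) x" for x
  have "d (tail F a) < d (head F a)" if a: "a \<in> arcs F" for a
  proof -
    let ?K = "?H (head F a)"
    have "\<exists>d :: 'a \<Rightarrow> nat. \<forall>(y, z) \<in> arcs_ends ?K. d y < d z"
      using arb[OF head_in_verts[OF a]] by (rule arborescence_parent_unique_and_ranked(1))
    then have "\<forall>(y, z) \<in> arcs_ends ?K. (SOME d :: 'a \<Rightarrow> nat. \<forall>(y, z) \<in> arcs_ends ?K. d y < d z) y
      < (SOME d :: 'a \<Rightarrow> nat. \<forall>(y, z) \<in> arcs_ends ?K. d y < d z) z"
      by (rule someI_ex)
    with arc(2)[OF a] show ?thesis
      unfolding d_def weak_component_eq_if_arc[OF wf_digraph_axioms a] by blast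
  qed
  then show "\<exists>d :: 'a \<Rightarrow> nat. \<forall>a \<in> arcs F. d (tail F a) < d (head F a)" by blast
qed

section \<open>Growing a forest along a sweep\<close>

text \<open>
  The invariant of the construction. Its last part says that no larger swept set has a boundary of at
  most \<open>card U\<close> vertices, while the boundary of \<open>X\<close> itself, being the set of tips, has exactly
  \<open>card U\<close> vertices.
\<close>

definition maximal_swept_expansion ::
  "('c, 'd) pre_digraph \<Rightarrow> nat \<Rightarrow> ('a \<times> 'a) set \<Rightarrow> 'a set \<Rightarrow> 'c set \<Rightarrow> bool" where
  "maximal_swept_expansion D k A U X \<longleftrightarrow>
     X \<subseteq> verts D \<and> swept (arcs_ends D) k X \<and>
     tipped_expansion D A U X (out_boundary (arcs_ends D) X) \<and>
     (\<forall>Y. X \<subset> Y \<longrightarrow> Y \<subseteq> verts D \<longrightarrow> swept (arcs_ends D) k Y \<longrightarrow>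
        card U < card (out_boundary (arcs_ends D) Y))"

context
  fixes D :: "('c, 'd) pre_digraph" and A :: "('a \<times> 'a) set" and d :: "'a \<Rightarrow> nat"
    and k :: nat and W :: "'a set"
  assumes D: "fin_digraph D" and not_swept: "\<not> swept (arcs_ends D) k (verts D)"
    and A: "A \<subseteq> W \<times> W" "\<And>x y. (x, y) \<in> A \<Longrightarrow> d x < d y"
      "\<And>x x' y. (x, y) \<in> A \<Longrightarrow> (x', y) \<in> A \<Longrightarrow> x = x'"
begin

interpretation D: fin_digraph D by (rule D)

text \<open>
  A vertex \<open>g\<close> of least rank outside \<open>U\<close> has its parent, if any, in \<open>U\<close>. Its branch set starts with an
  out-neighbour outside \<open>X\<close> of the tip of the parent, which exists because the tips are the
  out-boundary of \<open>X\<close>. If \<open>g\<close> is a root, any vertex outside \<open>X\<close> will do, and there is one because the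
  whole vertex set is not swept.
\<close>

lemma new_branch_vertex:
  assumes X: "maximal_swept_expansion D k A U X"
    and U: "U \<subset> W" "\<forall>x y. (x, y) \<in> A \<longrightarrow> y \<in> U \<longrightarrow> x \<in> U"
  obtains g v where "g \<in> W - U" "\<forall>x. (x, g) \<in> A \<longrightarrow> x \<in> U" "v \<in> verts D - X"
    "tipped_expansion D A (insert g U) (insert v X) (insert v (out_boundary (arcs_ends D) X))"
proof -
  have XD: "X \<subseteq> verts D" and X_swept: "swept (arcs_ends D) k X"
    and X_tip: "tipped_expansion D A U X (out_boundary (arcs_ends D) X)"
    using X by (auto simp: maximal_swept_expansion_def)
  obtain g where g: "g \<in> W - U" and min: "\<And>f. f \<in> W - U \<Longrightarrow> d g \<le> d f"
    using U(1) ex_has_least_nat[of "\<lambda>f. f \<in> W - U" _ d] by blast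
  have parent: "\<forall>x. (x, g) \<in> A \<longrightarrow> x \<in> U"
  proof (intro allI impI)
    fix x assume x: "(x, g) \<in> A"
    with A(1) min[of x] A(2)[OF x] show "x \<in> U" by auto
  qed
  have no_child: "(g, f) \<notin> A" if "f \<in> insert g U" for f
    using that g U(2) A(2)[of g g] by blast
  show thesis
  proof (cases "\<exists>p. (p, g) \<in> A")
    case True
    then obtain p where p: "(p, g) \<in> A" by blast
    have child: "((f, g) \<in> A \<longrightarrow> f = p) \<and> (g, f) \<notin> A" if "f \<in> insert g U" for f
      using A(3) p no_child[OF that] by blast
    obtain x where x: "x \<in> out_boundary (arcs_ends D) X" and grow: "\<And>v. (x, v) \<in> arcs_ends D \<Longrightarrow> v \<notin> X \<Longrightarrow>
        tipped_expansion D A (insert g U) (insert v X) (insert v (out_boundary (arcs_ends D) X))"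
      using tipped_expansion_new_child[OF X_tip parent[rule_format, OF p] p _ child] g by blast
    obtain v where v: "(x, v) \<in> arcs_ends D" "v \<notin> X" using x by (auto simp: out_boundary_def)
    show thesis
      using that[OF g parent _ grow[OF v]] v D.adj_in_verts(2)[OF v(1)] by simp
  next
    case False
    have "X \<noteq> verts D" using X_swept not_swept by blast
    with XD obtain v where v: "v \<in> verts D - X" by blast
    have "tipped_expansion D A (insert g U) (insert v X) (insert v (out_boundary (arcs_ends D) X))"
      using g v False no_child by (intro tipped_expansion_new_root[OF X_tip]) auto
    with that[OF g parent v] show thesis by blast
  qed
qed

lemma maximal_swept_expansion_empty:
  obtains X where "maximal_swept_expansion D k A {} X"
proof -
  have "card (out_boundary (arcs_ends D) {}) \<le> 0" by (simp add: out_boundary_def)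
  then obtain X where X: "X \<subseteq> verts D" "swept (arcs_ends D) k X" "card (out_boundary (arcs_ends D) X) \<le> 0"
    and max: "\<And>Y. X \<subset> Y \<Longrightarrow> Y \<subseteq> verts D \<Longrightarrow> swept (arcs_ends D) k Y \<Longrightarrow> 0 < card (out_boundary (arcs_ends D) Y)"
    using maximal_swept_superset[OF D.finite_verts empty_subsetI swept.empty] by metis
  have "finite (out_boundary (arcs_ends D) X)"
    using X(1) D.finite_verts by (meson finite_out_boundary finite_subset)
  with X(3) have "out_boundary (arcs_ends D) X = {}" by simp
  then have "maximal_swept_expansion D k A {} X"
    using X max tipped_expansion_empty by (simp add: maximal_swept_expansion_def)
  then show thesis by (rule that)
qed

text \<open>
  By maximality of \<open>X\<close> the set \<open>insert v X\<close>, which is swept, has the largest boundary that is possible,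
  namely \<open>insert v (out_boundary (arcs_ends D) X)\<close>. Let \<open>Z\<close> be a maximal swept superset with
  at most \<open>card U + 1\<close> boundary vertices. No set between \<open>insert v X\<close> and \<open>Z\<close> has a smaller boundary
  than \<open>insert v X\<close>: one of least boundary would be swept and contradict the maximality of \<open>X\<close>. So
  the tips can be moved to the boundary of \<open>Z\<close>, and they fill it by counting.
\<close>

lemma maximal_swept_expansion_insert:
  assumes X: "maximal_swept_expansion D k A U X" and U: "finite U" "card U < k" "g \<notin> U"
    and v: "v \<in> verts D - X"
    and tip: "tipped_expansion D A (insert g U) (insert v X) (insert v (out_boundary (arcs_ends D) X))"
  obtains Z where "maximal_swept_expansion D k A (insert g U) Z"
proof -
  let ?b = "out_boundary (arcs_ends D)" and ?X = "insert v X" and ?U = "insert g U"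
  have XD: "X \<subseteq> verts D" and X_swept: "swept (arcs_ends D) k X"
    and X_tip: "tipped_expansion D A U X (?b X)"
    and X_max: "\<And>Y. X \<subset> Y \<Longrightarrow> Y \<subseteq> verts D \<Longrightarrow> swept (arcs_ends D) k Y \<Longrightarrow> card U < card (?b Y)"
    using X by (auto simp: maximal_swept_expansion_def)
  have finb: "finite (?b Y)" if "Y \<subseteq> verts D" for Y
    using that D.finite_verts by (meson finite_out_boundary finite_subset)
  have card_U: "card ?U = Suc (card U)" using U by simp
  have X'_swept: "swept (arcs_ends D) k ?X"
    using X_swept v card_tips[OF X_tip] U(2) by (intro swept.insert) auto
  have X'D: "?X \<subseteq> verts D" using XD v by blast
  have X'_b: "?b ?X = insert v (?b X)"
  proof (rule card_seteq)
    show "finite (insert v (?b X))" using finb[OF XD] by simp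
    show "?b ?X \<subseteq> insert v (?b X)" by (rule out_boundary_insert)
    have "card U < card (?b ?X)" using X_max X'D X'_swept v by blast
    then show "card (insert v (?b X)) \<le> card (?b ?X)" using card_tips[OF tip] card_U by simp
  qed
  have "card (?b ?X) \<le> Suc (card U)" using X'_b card_tips[OF tip] card_U by simp
  then obtain Z where Z: "?X \<subseteq> Z" "Z \<subseteq> verts D" "swept (arcs_ends D) k Z" "card (?b Z) \<le> Suc (card U)"
    and Z_max: "\<And>Y. Z \<subset> Y \<Longrightarrow> Y \<subseteq> verts D \<Longrightarrow> swept (arcs_ends D) k Y \<Longrightarrow> Suc (card U) < card (?b Y)"
    by (rule maximal_swept_superset[OF D.finite_verts X'D X'_swept]) (rule that)
  have finZ: "finite Z" using Z(2) D.finite_verts by (rule finite_subset)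
  have sep: "card (?b ?X) \<le> card (?b Y)" if Y: "?X \<subseteq> Y" "Y \<subseteq> Z" for Y
  proof -
    have "\<exists>M. (?X \<subseteq> M \<and> M \<subseteq> Z) \<and>
        (\<forall>Y. ?X \<subseteq> Y \<and> Y \<subseteq> Z \<longrightarrow> card (?b M) \<le> card (?b Y))"
      by (rule ex_has_least_nat[of _ Y]) (use Y in simp)
    then obtain M where M: "?X \<subseteq> M" "M \<subseteq> Z"
      and M_min: "\<forall>Y. ?X \<subseteq> Y \<and> Y \<subseteq> Z \<longrightarrow> card (?b M) \<le> card (?b Y)"
      by (elim exE conjE)
    have "swept (arcs_ends D) k M"
    proof (rule swept_if_card_out_boundary_minimal[OF Z(3) finZ M(2)])
      fix Y' assume "M \<subseteq> Y'" "Y' \<subseteq> Z"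
      with M(1) M_min show "card (?b M) \<le> card (?b Y')" by (meson subset_trans)
    qed
    moreover have "X \<subset> M" "M \<subseteq> verts D" using M v Z(2) by auto
    ultimately have "card U < card (?b M)" by (intro X_max)
    moreover have "card (?b M) \<le> card (?b Y)" using M_min Y by simp
    ultimately show ?thesis using X'_b card_tips[OF tip] card_U by simp
  qed
  obtain T where T: "T \<subseteq> ?b Z" "tipped_expansion D A ?U Z T"
    using tipped_expansion_linkage[OF finZ Z(1) subset_refl sep tip[folded X'_b]] by blast
  have "T = ?b Z"
    using T(1) finb[OF Z(2)] Z(4) card_tips[OF T(2)] card_U by (intro card_seteq) auto
  with T Z Z_max card_U have "maximal_swept_expansion D k A ?U Z"
    by (simp add: maximal_swept_expansion_def)
  then show thesis by (rule that)
qed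

text \<open>
  The invariant is only needed up to the last but one vertex of \<open>W\<close>, which keeps the boundaries at
  most \<open>k\<close>: the branch set of the last vertex is a single vertex and need not be extended.
\<close>

lemma tipped_expansion_if_not_swept:
  assumes "finite W" "card W \<le> Suc k"
  shows "\<exists>T. tipped_expansion D A W (verts D) T"
proof (cases "W = {}")
  case True
  then show ?thesis using tipped_expansion_empty by blast
next
  case False
  have stage: "\<exists>U X. U \<subseteq> W \<and> card U = m \<and> (\<forall>x y. (x, y) \<in> A \<longrightarrow> y \<in> U \<longrightarrow> x \<in> U) \<and>
      maximal_swept_expansion D k A U X" if "m < card W" for m
    using that
  proof (induction m)
    case 0
    show ?case
      by (rule maximal_swept_expansion_empty) (intro exI[of _ "{}"] exI conjI; simp)
  next
    case (Suc m)
    then obtain U X where U: "U \<subseteq> W" "card U = m" "\<forall>x y. (x, y) \<in> A \<longrightarrow> y \<in> U \<longrightarrow> x \<in> U"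
      and X: "maximal_swept_expansion D k A U X" by auto
    have "U \<noteq> W" using U(2) Suc.prems by auto
    with U(1) have psub: "U \<subset> W" by blast
    have finU: "finite U" using U(1) assms(1) by (rule finite_subset)
    obtain g v where g: "g \<in> W - U" "\<forall>x. (x, g) \<in> A \<longrightarrow> x \<in> U" and v: "v \<in> verts D - X"
      and tip: "tipped_expansion D A (insert g U) (insert v X) (insert v (out_boundary (arcs_ends D) X))"
      using new_branch_vertex[OF X psub U(3)] by blast
    have "card U < k" "g \<notin> U" using U(2) Suc.prems assms(2) g by auto
    then obtain Z where "maximal_swept_expansion D k A (insert g U) Z"
      using maximal_swept_expansion_insert[OF X finU _ _ v tip] by blast
    then show ?case
      using U g finU by (intro exI[of _ "insert g U"] exI[of _ Z]) auto
  qed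
  have "card W - 1 < card W" using False assms(1) by (simp add: card_gt_0_iff)
  from stage[OF this] obtain U X where U: "U \<subseteq> W" "card U = card W - 1"
      "\<forall>x y. (x, y) \<in> A \<longrightarrow> y \<in> U \<longrightarrow> x \<in> U"
    and X: "maximal_swept_expansion D k A U X" by blast
  have "U \<noteq> W" using U(2) \<open>card W - 1 < card W\<close> by auto
  with U(1) have psub: "U \<subset> W" by blast
  have finU: "finite U" using U(1) assms(1) by (rule finite_subset)
  obtain g v where g: "g \<in> W - U" and v: "v \<in> verts D - X"
    and tip: "tipped_expansion D A (insert g U) (insert v X) (insert v (out_boundary (arcs_ends D) X))"
    using new_branch_vertex[OF X psub U(3)] by blast
  have "insert g U = W"
    using g U(1,2) assms(1) finU by (intro card_seteq) auto
  moreover have "insert v X \<subseteq> verts D" using X v by (auto simp: maximal_swept_expansion_def)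
  ultimately show ?thesis using tipped_expansion_mono[OF tip] by auto
qed

end

theorem theorem5:
  fixes F :: "('a, 'b) pre_digraph" and D :: "('c, 'd) pre_digraph"
  assumes "fin_digraph F" and "forest_of_arborescences F"
    and "fin_digraph D"
    and "directed_path_width D \<ge> int (card (verts F)) - 1"
  shows "\<exists>D'. has_butterfly_minor D D' \<and> digraph_iso D' F"
proof -
  interpret F: fin_digraph F by fact
  interpret D: fin_digraph D by fact
  note inj = forest_of_arborescences_parent_unique_and_ranked(1)[OF assms(2)]
  obtain d :: "'a \<Rightarrow> nat" where d: "\<And>a. a \<in> arcs F \<Longrightarrow> d (tail F a) < d (head F a)"
    using forest_of_arborescences_parent_unique_and_ranked(2)[OF assms(2)] by blast
  have F: "nomulti_digraph F"
    using inj by unfold_locales (auto simp: arc_to_ends_def dest: inj_onD)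
  have irrefl: "(f, f) \<notin> arcs_ends F" for f
  proof
    assume "(f, f) \<in> arcs_ends F"
    then obtain a where "a \<in> arcs F" "tail F a = f" "head F a = f" by (auto simp: arcs_ends_conv)
    with d[of a] show False by simp
  qed
  \<comment> \<open>Bags of at most \<open>card (verts F) - 1\<close> vertices would give a width of at most
    \<open>card (verts F) - 2\<close>.\<close>
  define k where "k = card (verts F) - 1"
  have "\<exists>T. tipped_expansion D (arcs_ends F) (verts F) (verts D) T"
  proof (cases "verts F = {}")
    case True
    show ?thesis unfolding True using tipped_expansion_empty by blast
  next
    case False
    then have "0 < card (verts F)" by (simp add: card_gt_0_iff)
    with assms(4) have "\<not> swept (arcs_ends D) k (verts D)"
      using directed_path_width_less_if_swept[OF assms(3), of k] by (auto simp: k_def)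
    then show ?thesis
    proof (rule tipped_expansion_if_not_swept[OF assms(3)])
      show "arcs_ends F \<subseteq> verts F \<times> verts F" using F.adj_in_verts by auto
      show "d x < d y" if "(x, y) \<in> arcs_ends F" for x y
        using that d by (auto simp: arcs_ends_conv)
      show "x = x'" if "(x, y) \<in> arcs_ends F" "(x', y) \<in> arcs_ends F" for x x' y
        using that inj by (auto simp: arcs_ends_conv dest: inj_onD)
    qed (simp_all add: k_def)
  qed
  then obtain S R \<beta> where S: "S \<subseteq> verts D" and R: "R \<subseteq> arcs D"
    and exp: "expansion (arcs_ends F) (verts F) (D\<lparr>verts := S, arcs := R\<rparr>) \<beta>"
    by (auto simp: tipped_expansion_def)
  have "has_butterfly_minor D (D\<lparr>verts := S, arcs := R\<rparr>)"
    using exp S R by (intro has_butterfly_minor_subgraph[OF assms(3)]) (simp_all add: expansion_def)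
  moreover have "finite (arcs (D\<lparr>verts := S, arcs := R\<rparr>))"
    using R D.finite_arcs by (simp add: finite_subset)
  from butterfly_minor_if_expansion[OF this exp F irrefl]
  obtain K where "has_butterfly_minor (D\<lparr>verts := S, arcs := R\<rparr>) K" "digraph_iso K F"
    by (elim exE conjE)
  ultimately show ?thesis using has_butterfly_minor_trans by blast
qed

end
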